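(* Let $D$ be a dataset and $\lambda$ an error function with optimal model $h^*_\lambda(D)\in\mathbb{R}^d$. Let $\epsilon_s$ be the square loss $\epsilon_s(h,D)=\|h-h^*_\lambda(D)\|_2^2$. A pricing function $p_{\epsilon_s,\lambda}$ is arbitrage-free (in $D$) for the Gaussian mechanism $\mathcal{K}_G$ if and only if the following two conditions hold for every $\delta_1,\delta_2,\delta_3>0$: 1. if $1/\delta_1=1/\delta_2+1/\delta_3$, then $p_{\epsilon_s,\lambda}(\delta_1,D)\le p_{\epsilon_s,\lambda}(\delta_2,D)+p_{\epsilon_s,\lambda}(\delta_3,D)$; 2. if $\delta_1\le\delta_2$, then $p_{\epsilon_s,\lambda}(\delta_1,D)\ge p_{\epsilon_s,\lambda}(\delta_2,D)$.
   Context: The hypothesis space $\mathcal{H}$ consists of vectors in $\mathbb{R}^d$. For a dataset $D$ and an error function $\lambda(h,D)\in[0,\infty)$, $h^*_\lambda(D)=\arg\min_{h\in\mathcal{H}}\lambda(h,D)$ is the optimal model. Gaussian mechanism $\mathcal{K}_G$: for a parameter $\delta>0$, it outputs $\hat h^\delta_\lambda(D)=h^*_\lambda(D)+w$ with $w\sim\mathcal{N}(\mathbf{0},(\delta/d)\mathbf{I}_d)$, where $\mathbf{I}_d$ is the $d\times d$ identity matrix. Model instances bought separately use independent noise vectors. A pricing function assigns a price $p_{\epsilon_s,\lambda}(\delta,D)\in[0,\infty)$ to each parameter $\delta$. $k$-arbitrage: the pricing function exhibits $k$-arbitrage in $D$ if there exist parameters $\delta_0,\delta_1,\dots,\delta_k$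 and a function $g:\mathcal{H}^k\to\mathcal{H}$ such that (i) $\sum_{i=1}^k p_{\epsilon_s,\lambda}(\delta_i,D)<p_{\epsilon_s,\lambda}(\delta_0,D)$, and (ii) $\mathbb{E}[\epsilon_s(\tilde h,D)]\le\mathbb{E}[\epsilon_s(\hat h^{\delta_0}_\lambda(D),D)]$, where $\tilde h=g(\hat h^{\delta_1}_\lambda(D),\dots,\hat h^{\delta_k}_\lambda(D))$ is such that $\mathbb{E}[\tilde h]=h^*_\lambda(D)$. The pricing function is arbitrage-free in $D$ if it does not exhibit $k$-arbitrage for any integer $k\ge1$.
   Formalization: In the definition of k-arbitrage, g must be unbiased for every possible value of the optimal model, not only the actual one: otherwise the constant function g equal to the optimal model gives arbitrage even for p = 1/δ, which satisfies both conditions. g is also taken Borel measurable. *)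

theory Defs
  imports "HOL-Probability.Probability"
begin

definition error_function :: "(real ^ 'd \<Rightarrow> 'D \<Rightarrow> real) \<Rightarrow> bool" where
  "error_function err \<longleftrightarrow> (\<forall>h D. 0 \<le> err h D)"

definition has_optimal_model :: "(real ^ 'd \<Rightarrow> 'D \<Rightarrow> real) \<Rightarrow> 'D \<Rightarrow> bool" where
  "has_optimal_model err D \<longleftrightarrow> (\<exists>h. is_arg_min (\<lambda>h. err h D) (\<lambda>_. True) h)"

definition optimal_model :: "(real ^ 'd \<Rightarrow> 'D \<Rightarrow> real) \<Rightarrow> 'D \<Rightarrow> real ^ 'd" where
  "optimal_model err D = (ARG_MIN (\<lambda>h. err h D) h. True)"

definition square_loss ::
  "(real ^ 'd::finite \<Rightarrow> 'D \<Rightarrow> real) \<Rightarrow> real ^ 'd \<Rightarrow> 'D \<Rightarrow> real" where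
  "square_loss err h D = (norm (h - optimal_model err D))\<^sup>2"

text \<open>The formula below is the normal law with mean \<open>\<mu>\<close> and covariance \<open>\<Sigma>\<close> when \<open>\<Sigma>\<close> is
  symmetric and positive definite.\<close>

definition multivariate_normal :: "real ^ 'd::finite \<Rightarrow> real ^ 'd ^ 'd \<Rightarrow> (real ^ 'd) measure" where
  "multivariate_normal \<mu> \<Sigma> = density lborel (\<lambda>x. ennreal
     (exp (- ((x - \<mu>) \<bullet> (matrix_inv \<Sigma> *v (x - \<mu>))) / 2) / sqrt ((2 * pi) ^ CARD('d) * det \<Sigma>)))"

text \<open>The law of \<open>\<theta> + w\<close> with \<open>w\<close> distributed as \<open>N(0, (\<delta>/d) I)\<close>. The model instance sold for
  \<open>D\<close> is the case where \<open>\<theta>\<close> is the optimal model of \<open>D\<close>.\<close>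

definition gaussian_mechanism :: "real \<Rightarrow> real ^ 'd::finite \<Rightarrow> (real ^ 'd) measure" where
  "gaussian_mechanism \<delta> \<theta> =
     distr (multivariate_normal 0 ((\<delta> / real CARD('d)) *\<^sub>R mat 1)) borel (\<lambda>w. \<theta> + w)"

definition independent_instances ::
  "nat \<Rightarrow> (nat \<Rightarrow> real) \<Rightarrow> real ^ 'd::finite \<Rightarrow> (nat \<Rightarrow> real ^ 'd) measure" where
  "independent_instances k \<delta> \<theta> = PiM {1..k} (\<lambda>i. gaussian_mechanism (\<delta> i) \<theta>)"

text \<open>Unbiasedness in the sense of estimation theory: \<open>g\<close> cannot depend on the unknown optimal
  model, so the identity is required for every value \<open>\<theta>\<close> that model may take. Required at one
  fixed \<open>\<theta>\<close> only, it would be satisfied by the constant function \<open>\<theta>\<close>, which has zero loss.\<close>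

definition unbiased ::
  "nat \<Rightarrow> (nat \<Rightarrow> real) \<Rightarrow> ((nat \<Rightarrow> real ^ 'd::finite) \<Rightarrow> real ^ 'd) \<Rightarrow> bool" where
  "unbiased k \<delta> g \<longleftrightarrow> (\<forall>\<theta>. has_bochner_integral (independent_instances k \<delta> \<theta>) g \<theta>)"

definition pricing_function :: "(real \<Rightarrow> 'D \<Rightarrow> real) \<Rightarrow> bool" where
  "pricing_function p \<longleftrightarrow> (\<forall>\<delta>>0. \<forall>D. 0 \<le> p \<delta> D)"

text \<open>Expected losses are nonnegative integrals with values in \<open>[0, \<infinity>]\<close>, so that an estimator of
  infinite expected loss does not qualify (its Bochner integral would be \<open>0\<close>).\<close>

definition k_arbitrage ::
  "nat \<Rightarrow> (real ^ 'd::finite \<Rightarrow> 'D \<Rightarrow> real) \<Rightarrow> (real ^ 'd \<Rightarrow> 'D \<Rightarrow> real) \<Rightarrow>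
   (real \<Rightarrow> 'D \<Rightarrow> real) \<Rightarrow> 'D \<Rightarrow> bool" where
  "k_arbitrage k loss err p D \<longleftrightarrow>
     (\<exists>(\<delta> :: nat \<Rightarrow> real) (g :: (nat \<Rightarrow> real ^ 'd) \<Rightarrow> real ^ 'd).
        (\<forall>i\<le>k. 0 < \<delta> i) \<and>
        g \<in> borel_measurable (PiM {1..k} (\<lambda>_. borel)) \<and>
        (\<Sum>i=1..k. p (\<delta> i) D) < p (\<delta> 0) D \<and>
        unbiased k \<delta> g \<and>
        (\<integral>\<^sup>+ hs. ennreal (loss (g hs) D) \<partial>independent_instances k \<delta> (optimal_model err D))
          \<le> (\<integral>\<^sup>+ h. ennreal (loss h D) \<partial>gaussian_mechanism (\<delta> 0) (optimal_model err D)))"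

definition arbitrage_free ::
  "(real ^ 'd::finite \<Rightarrow> 'D \<Rightarrow> real) \<Rightarrow> (real ^ 'd \<Rightarrow> 'D \<Rightarrow> real) \<Rightarrow>
   (real \<Rightarrow> 'D \<Rightarrow> real) \<Rightarrow> 'D \<Rightarrow> bool" where
  "arbitrage_free loss err p D \<longleftrightarrow> (\<forall>k\<ge>1. \<not> k_arbitrage k loss err p D)"

end

theory Submission
  imports Defs
begin

text \<open>
  Independent instances with parameters \<open>\<delta>\<^sub>1, \<dots>, \<delta>\<^sub>k\<close> can be combined into an unbiased estimator of mean
  square error at most \<open>\<delta>\<^sub>0\<close> if and only if \<open>1 / \<delta>\<^sub>0 \<le> 1 / \<delta>\<^sub>1 + \<dots> + 1 / \<delta>\<^sub>k\<close>. The average with weights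
  proportional to \<open>1 / \<delta>\<^sub>i\<close> attains equality. That nothing does better is the Cramer-Rao bound. To avoid
  differentiating under the integral sign, it is obtained from finite shifts of the optimal model
  (Hammersley, Chapman and Robbins): unbiasedness at \<open>\<theta> + t b\<close> is a statement about the likelihood
  ratio, whose second moment is explicit, and \<open>t\<close> then tends to 0. So arbitrage-freeness says that
  \<open>p\<close>, as a function of the precision \<open>1 / \<delta>\<close>, is monotone and subadditive.
\<close>

section \<open>The Gaussian mechanism\<close>

lemma matrix_inv_scaleR_mat_1:
  fixes c :: real
  assumes "c \<noteq> 0"
  shows "matrix_inv (c *\<^sub>R mat 1 :: real ^ 'n::finite ^ 'n) = (1 / c) *\<^sub>R mat 1"
proof -
  let ?P = "\<lambda>B :: real ^ 'n ^ 'n. c *\<^sub>R mat 1 ** B = mat 1 \<and> B ** c *\<^sub>R mat 1 = mat 1"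
  have "?P ((1 / c) *\<^sub>R mat 1)"
    using assms by (simp add: matrix_scalar_ac flip: scalar_matrix_assoc)
  \<comment> \<open>\<open>matrix_inv\<close> is a Hilbert choice, so exhibiting an inverse does not
    fix its value; uniqueness does.\<close>
  moreover have "B = (1 / c) *\<^sub>R mat 1" if "?P B" for B
  proof -
    have "c *\<^sub>R B = mat 1"
      using that by (simp flip: scalar_matrix_assoc)
    then show ?thesis using assms by (simp flip: \<open>c *\<^sub>R B = mat 1\<close>)
  qed
  ultimately show ?thesis
    unfolding matrix_inv_def by (rule some_equality)
qed

lemma det_scaleR_mat_1: "det (c *\<^sub>R mat 1 :: real ^ 'n::finite ^ 'n) = c ^ CARD('n)"
proof -
  have "(c *\<^sub>R mat 1 :: real ^ 'n ^ 'n) = matrix ((*\<^sub>R) c)"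
    by (simp add: matrix_def mat_def axis_def vec_eq_iff)
  then show ?thesis by simp
qed

lemma power2_norm_eq_sum_inner:
  fixes x :: "'a::euclidean_space"
  shows "(norm x)\<^sup>2 = (\<Sum>b\<in>Basis. (x \<bullet> b)\<^sup>2)"
  by (subst power2_norm_eq_inner, subst euclidean_inner) (simp add: power2_eq_square)

text \<open>Bridges two forms of the isotropic density: the exponential matches
  \<open>multivariate_normal\<close>, while the product over coordinates is what Fubini can
  integrate.\<close>

lemma prod_normal_density:
  fixes x \<mu> :: "'a::euclidean_space"
  shows "(\<Prod>b\<in>Basis. normal_density (\<mu> \<bullet> b) \<sigma> (x \<bullet> b)) =
    exp (- (norm (x - \<mu>))\<^sup>2 / (2 * \<sigma>\<^sup>2)) / sqrt ((2 * pi * \<sigma>\<^sup>2) ^ DIM('a))"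
proof -
  have "(norm (x - \<mu>))\<^sup>2 = (\<Sum>b\<in>Basis. (x \<bullet> b - \<mu> \<bullet> b)\<^sup>2)"
    by (simp add: power2_norm_eq_sum_inner inner_diff_left)
  then show ?thesis
    by (simp add: normal_density_def prod.distrib prod_dividef real_sqrt_power sum_negf
        flip: exp_sum sum_divide_distrib)
qed

text \<open>Translation invariance of Lebesgue measure moves the shift by \<theta> from the noise
  into the mean of the density.\<close>

lemma gaussian_mechanism_eq_density:
  fixes \<theta> :: "real ^ 'd::finite"
  assumes "0 < \<delta>"
  shows "gaussian_mechanism \<delta> \<theta> = density lborel
    (\<lambda>x. \<Prod>b\<in>Basis. normal_density (\<theta> \<bullet> b) (sqrt (\<delta> / real CARD('d))) (x \<bullet> b))"
proof -
  define c where "c = \<delta> / real CARD('d)"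
  let ?f = "\<lambda>x. \<Prod>b\<in>Basis. normal_density (\<theta> \<bullet> b) (sqrt c) (x \<bullet> b)"
  have c: "0 < c" using assms by (simp add: c_def)
  have "multivariate_normal 0 (c *\<^sub>R mat 1) = density lborel (\<lambda>w :: real ^ 'd. ennreal (?f (\<theta> + w)))"
    unfolding multivariate_normal_def
  proof (intro arg_cong2[where f = density] refl ext arg_cong[where f = ennreal])
    fix w :: "real ^ 'd"
    have q: "w \<bullet> (matrix_inv (c *\<^sub>R mat 1) *v w) = (norm w)\<^sup>2 / c"
      using c by (subst matrix_inv_scaleR_mat_1)
        (auto simp flip: scaleR_matrix_vector_assoc simp: power2_norm_eq_inner)
    show "exp (- ((w - 0) \<bullet> (matrix_inv (c *\<^sub>R mat 1) *v (w - 0))) / 2) /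
        sqrt ((2 * pi) ^ CARD('d) * det (c *\<^sub>R mat 1 :: real ^ 'd ^ 'd)) = ?f (\<theta> + w)"
      unfolding prod_normal_density det_scaleR_mat_1 diff_zero q
      using c by (simp add: power_mult_distrib)
  qed
  then have "gaussian_mechanism \<delta> \<theta> = distr (density lborel (\<lambda>w. ennreal (?f (\<theta> + w)))) borel ((+) \<theta>)"
    by (simp add: gaussian_mechanism_def c_def)
  also have "\<dots> = density (distr lborel borel ((+) \<theta>)) (\<lambda>x. ennreal (?f x))"
    by (rule density_distr[symmetric]) auto
  finally show ?thesis by (simp add: lborel_distr_plus c_def)
qed

lemma sets_gaussian_mechanism [measurable_cong, simp]:
  "sets (gaussian_mechanism \<delta> \<theta>) = sets borel"
  by (simp add: gaussian_mechanism_def)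

lemma gaussian_mechanism_coordinate:
  fixes \<theta> :: "real ^ 'd::finite"
  assumes "0 < \<delta>" and b: "b \<in> Basis"
  shows "distributed (gaussian_mechanism \<delta> \<theta>) lborel (\<lambda>x. x \<bullet> b)
    (normal_density (\<theta> \<bullet> b) (sqrt (\<delta> / real CARD('d))))"
  unfolding distributed_def
proof (intro conjI)
  let ?\<sigma> = "sqrt (\<delta> / real CARD('d))"
  let ?n = "\<lambda>b. normal_density (\<theta> \<bullet> b) ?\<sigma>"
  let ?G = "gaussian_mechanism \<delta> \<theta>"
  have \<sigma>: "0 < ?\<sigma>" using assms by simp
  show "distr ?G lborel (\<lambda>x. x \<bullet> b) = density lborel (\<lambda>x. ennreal (?n b x))"
  proof (rule measure_eqI)
    fix A assume "A \<in> sets (distr ?G lborel (\<lambda>x. x \<bullet> b))"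
    then have A [measurable]: "A \<in> sets borel" by simp
    \<comment> \<open>The indicator is attached to the factor of coordinate \<open>b\<close> alone,
      so Fubini leaves one integral over \<open>A\<close> while every other factor integrates to
      1.\<close>
    let ?F = "\<lambda>b' y. ennreal (?n b' y) * (if b' = b then indicator A y else 1)"
    have "emeasure (distr ?G lborel (\<lambda>x. x \<bullet> b)) A = (\<integral>\<^sup>+x. indicator A (x \<bullet> b) \<partial>?G)"
      by (subst nn_integral_indicator[symmetric], simp, subst nn_integral_distr) auto
    also have "\<dots> = (\<integral>\<^sup>+x. (\<Prod>b'\<in>Basis. ?F b' (x \<bullet> b')) \<partial>lborel)"
      unfolding gaussian_mechanism_eq_density[OF assms(1)]
      using b by (subst nn_integral_density)
        (auto simp: prod.distrib prod.delta' prod.delta prod_ennreal normal_density_nonneg cong: prod.cong intro!: nn_integral_cong)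
    also have "\<dots> = (\<Prod>b'\<in>Basis. \<integral>\<^sup>+y. ?F b' y \<partial>lborel)"
      by (rule nn_integral_lborel_prod) auto
    also have "\<dots> = (\<Prod>b'\<in>Basis. if b' = b then \<integral>\<^sup>+y. ennreal (?n b y) * indicator A y \<partial>lborel else 1)"
      using \<sigma> by (intro prod.cong) (auto simp: nn_integral_eq_integral normal_density_nonneg)
    also have "\<dots> = emeasure (density lborel (\<lambda>x. ennreal (?n b x))) A"
      using b by (simp add: emeasure_density)
    finally show "emeasure (distr ?G lborel (\<lambda>x. x \<bullet> b)) A = \<dots>" .
  qed simp
qed auto

text \<open>A pushforward keeps the total mass, so one coordinate with a normal law settles
  it.\<close>

lemma prob_space_gaussian_mechanism:
  fixes \<theta> :: "real ^ 'd::finite"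
  assumes "0 < \<delta>"
  shows "prob_space (gaussian_mechanism \<delta> \<theta>)"
proof -
  obtain b :: "real ^ 'd" where b: "b \<in> Basis" using nonempty_Basis by blast
  have "prob_space (distr (gaussian_mechanism \<delta> \<theta>) lborel (\<lambda>x. x \<bullet> b))"
    using gaussian_mechanism_coordinate[OF assms b, of \<theta>] assms
    by (simp add: distributed_def prob_space_normal_density)
  then show ?thesis by (rule prob_space_distrD[rotated]) auto
qed

text \<open>Expanding the square in the exponent leaves a ratio of densities whose logarithm is
  affine in \<open>x\<close>; the factor \<open>d / \<delta>\<close> is the inverse of the variance
  of a coordinate.\<close>

lemma gaussian_mechanism_shift:
  fixes \<theta> h :: "real ^ 'd::finite"
  assumes "0 < \<delta>"
  shows "gaussian_mechanism \<delta> (\<theta> + h) = density (gaussian_mechanism \<delta> \<theta>)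
    (\<lambda>x. ennreal (exp (real CARD('d) / \<delta> * (h \<bullet> (x - \<theta>) - (norm h)\<^sup>2 / 2))))"
proof -
  let ?\<sigma> = "sqrt (\<delta> / real CARD('d))"
  let ?f = "\<lambda>\<theta> x. \<Prod>b\<in>Basis. normal_density (\<theta> \<bullet> b) ?\<sigma> (x \<bullet> b)"
  let ?L = "\<lambda>x. exp (real CARD('d) / \<delta> * (h \<bullet> (x - \<theta>) - (norm h)\<^sup>2 / 2))"
  have "?f (\<theta> + h) x = ?f \<theta> x * ?L x" for x
  proof -
    have "(norm (x - (\<theta> + h)))\<^sup>2 = (norm (x - \<theta>))\<^sup>2 - 2 * (h \<bullet> (x - \<theta>)) + (norm h)\<^sup>2"
      unfolding power2_norm_eq_inner
      by (simp add: inner_diff_left inner_diff_right inner_add_left inner_add_right inner_commute)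
    then have "- (norm (x - (\<theta> + h)))\<^sup>2 / (2 * ?\<sigma>\<^sup>2) = - (norm (x - \<theta>))\<^sup>2 / (2 * ?\<sigma>\<^sup>2) +
        real CARD('d) / \<delta> * (h \<bullet> (x - \<theta>) - (norm h)\<^sup>2 / 2)"
      by (simp only:) (use assms in \<open>simp add: field_simps\<close>)
    then show ?thesis
      unfolding prod_normal_density by (simp only: exp_add times_divide_eq_left)
  qed
  then have "ennreal (?f (\<theta> + h) x) = ennreal (?f \<theta> x) * ennreal (?L x)" for x
    by (simp only: ennreal_mult'' exp_ge_zero)
  then show ?thesis
    unfolding gaussian_mechanism_eq_density[OF assms]
    by (subst density_density_eq) auto
qed

text \<open>Mean and squared norm split over coordinates, so the marginal laws suffice. In this form
  the result serves both a single instance and a weighted sum of instances.\<close>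

lemma (in prob_space)
  fixes X :: "'a \<Rightarrow> 'b::euclidean_space" and \<sigma> :: real
  assumes \<sigma>: "0 < \<sigma>" and X [measurable]: "X \<in> borel_measurable M"
    and D: "\<And>b. b \<in> Basis \<Longrightarrow> distributed M lborel (\<lambda>x. X x \<bullet> b) (normal_density (\<theta> \<bullet> b) \<sigma>)"
  shows has_bochner_integral_normal_coordinates: "has_bochner_integral M X \<theta>"
    and nn_integral_norm_normal_coordinates:
      "(\<integral>\<^sup>+x. ennreal ((norm (X x - \<theta>))\<^sup>2) \<partial>M) = ennreal (DIM('b) * \<sigma>\<^sup>2)"
proof -
  have "has_bochner_integral M (\<lambda>x. \<Sum>b\<in>Basis. (X x \<bullet> b) *\<^sub>R b) (\<Sum>b\<in>Basis. (\<theta> \<bullet> b) *\<^sub>R b)"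
  proof (intro has_bochner_integral_sum has_bochner_integral_scaleR_left)
    fix b :: 'b assume b: "b \<in> Basis"
    have "integrable M (\<lambda>x. X x \<bullet> b)"
      using distributed_integrable[OF D[OF b], of "\<lambda>x. x"] integrable_normal_moment_nz_1[OF \<sigma>]
      by (simp add: normal_density_nonneg)
    then show "has_bochner_integral M (\<lambda>x. X x \<bullet> b) (\<theta> \<bullet> b)"
      by (simp add: has_bochner_integral_iff normal_distributed_expectation[OF \<sigma> D[OF b]])
  qed
  then show "has_bochner_integral M X \<theta>"
    by (simp add: euclidean_representation)
  have "(\<integral>\<^sup>+x. ennreal ((norm (X x - \<theta>))\<^sup>2) \<partial>M) =
      (\<integral>\<^sup>+x. (\<Sum>b\<in>Basis. ennreal ((X x \<bullet> b - \<theta> \<bullet> b)\<^sup>2)) \<partial>M)"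
  proof (rule nn_integral_cong)
    fix x
    have "(norm (X x - \<theta>))\<^sup>2 = (\<Sum>b\<in>Basis. (X x \<bullet> b - \<theta> \<bullet> b)\<^sup>2)"
      by (simp add: power2_norm_eq_sum_inner inner_diff_left)
    then show "ennreal ((norm (X x - \<theta>))\<^sup>2) = (\<Sum>b\<in>Basis. ennreal ((X x \<bullet> b - \<theta> \<bullet> b)\<^sup>2))"
      by (simp add: sum_ennreal)
  qed
  also have "\<dots> = (\<Sum>b\<in>Basis. \<integral>\<^sup>+x. ennreal ((X x \<bullet> b - \<theta> \<bullet> b)\<^sup>2) \<partial>M)"
    by (rule nn_integral_sum) auto
  also have "\<dots> = (\<Sum>b\<in>(Basis :: 'b set). ennreal (\<sigma>\<^sup>2))"
  proof (rule sum.cong[OF refl])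
    fix b :: 'b assume b: "b \<in> Basis"
    have *: "has_bochner_integral lborel (\<lambda>y. normal_density (\<theta> \<bullet> b) \<sigma> y * (y - \<theta> \<bullet> b)\<^sup>2) (\<sigma>\<^sup>2)"
      using normal_moment_even[OF \<sigma>, of "\<theta> \<bullet> b" 1] by (simp add: fact_numeral)
    have "(\<integral>\<^sup>+x. ennreal ((X x \<bullet> b - \<theta> \<bullet> b)\<^sup>2) \<partial>M) =
        (\<integral>\<^sup>+y. ennreal (normal_density (\<theta> \<bullet> b) \<sigma> y) * ennreal ((y - \<theta> \<bullet> b)\<^sup>2) \<partial>lborel)"
      by (rule distributed_nn_integral[OF D[OF b], symmetric]) auto
    also have "\<dots> = (\<integral>\<^sup>+y. ennreal (normal_density (\<theta> \<bullet> b) \<sigma> y * (y - \<theta> \<bullet> b)\<^sup>2) \<partial>lborel)"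
      by (simp add: ennreal_mult normal_density_nonneg)
    also have "\<dots> = ennreal (\<sigma>\<^sup>2)"
      using * by (subst nn_integral_eq_integral)
        (auto simp: has_bochner_integral_iff normal_density_nonneg)
    finally show "(\<integral>\<^sup>+x. ennreal ((X x \<bullet> b - \<theta> \<bullet> b)\<^sup>2) \<partial>M) = ennreal (\<sigma>\<^sup>2)" .
  qed
  finally show "(\<integral>\<^sup>+x. ennreal ((norm (X x - \<theta>))\<^sup>2) \<partial>M) = ennreal (DIM('b) * \<sigma>\<^sup>2)"
    by (simp add: ennreal_mult ennreal_of_nat_eq_real_of_nat)
qed

text \<open>Each of the \<open>d\<close> coordinates has variance \<open>\<delta> / d\<close>, so
  the parameter is itself the expected square loss.\<close>

lemma gaussian_mechanism_mse:
  fixes \<theta> :: "real ^ 'd::finite"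
  assumes "0 < \<delta>"
  shows "(\<integral>\<^sup>+x. ennreal ((norm (x - \<theta>))\<^sup>2) \<partial>gaussian_mechanism \<delta> \<theta>) = ennreal \<delta>"
proof -
  interpret prob_space "gaussian_mechanism \<delta> \<theta>"
    by (rule prob_space_gaussian_mechanism[OF assms])
  show ?thesis
    using assms nn_integral_norm_normal_coordinates[of "sqrt (\<delta> / real CARD('d))" "\<lambda>x. x" \<theta>]
    by (simp add: gaussian_mechanism_coordinate)
qed

section \<open>Linear estimators\<close>

lemma sets_independent_instances [measurable_cong, simp]:
  "sets (independent_instances k \<delta> \<theta>) = sets (PiM {1..k} (\<lambda>_. borel))"
  unfolding independent_instances_def by (intro sets_PiM_cong) auto

lemma prob_space_independent_instances:
  assumes "\<forall>i\<in>{1..k}. 0 < \<delta> i"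
  shows "prob_space (independent_instances k \<delta> \<theta>)"
  unfolding independent_instances_def
  using assms by (intro prob_space_PiM prob_space_gaussian_mechanism) auto

lemma indep_vars_independent_instances:
  assumes "1 \<le> k" and \<delta>: "\<forall>i\<in>{1..k}. 0 < \<delta> i"
  shows "prob_space.indep_vars (independent_instances k \<delta> \<theta>) (\<lambda>_. borel) (\<lambda>i hs. hs i) {1..k}"
proof -
  interpret prob_space "independent_instances k \<delta> \<theta>"
    by (rule prob_space_independent_instances[OF \<delta>])
  \<comment> \<open>Points of the product space are extensional, so restriction to
    \<open>{1..k}\<close> is the identity there. The joint law of the coordinates is therefore the
    product measure itself, which is the criterion for independence.\<close>
  have "distr (independent_instances k \<delta> \<theta>) (PiM {1..k} (\<lambda>_. borel)) (\<lambda>hs. \<lambda>i\<in>{1..k}. hs i) =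
      distr (independent_instances k \<delta> \<theta>) (independent_instances k \<delta> \<theta>) (\<lambda>hs. hs)"
    by (intro distr_cong refl sets_independent_instances[symmetric])
      (auto simp: independent_instances_def space_PiM PiE_iff extensional_restrict)
  also have "\<dots> = (\<Pi>\<^sub>M i\<in>{1..k}. distr (independent_instances k \<delta> \<theta>) borel (\<lambda>hs. hs i))"
    unfolding distr_id
    unfolding independent_instances_def
  proof (intro PiM_cong refl)
    fix i assume i: "i \<in> {1..k}"
    have "distr (\<Pi>\<^sub>M i\<in>{1..k}. gaussian_mechanism (\<delta> i) \<theta>) (gaussian_mechanism (\<delta> i) \<theta>) (\<lambda>hs. hs i) =
        gaussian_mechanism (\<delta> i) \<theta>"
      using i \<delta> by (intro distr_PiM_component prob_space_gaussian_mechanism) auto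
    then show "gaussian_mechanism (\<delta> i) \<theta> =
        distr (\<Pi>\<^sub>M i\<in>{1..k}. gaussian_mechanism (\<delta> i) \<theta>) borel (\<lambda>hs. hs i)"
      by (simp cong: distr_cong)
  qed
  finally show ?thesis
    using assms(1) by (subst indep_vars_iff_distr_eq_PiM') auto
qed

lemma independent_instances_coordinate:
  fixes \<theta> :: "real ^ 'd::finite"
  assumes \<delta>: "\<forall>i\<in>{1..k}. 0 < \<delta> i" and i: "i \<in> {1..k}" and b: "b \<in> Basis"
  shows "distributed (independent_instances k \<delta> \<theta>) lborel (\<lambda>hs. hs i \<bullet> b)
    (normal_density (\<theta> \<bullet> b) (sqrt (\<delta> i / real CARD('d))))"
proof -
  have "distr (independent_instances k \<delta> \<theta>) (gaussian_mechanism (\<delta> i) \<theta>) (\<lambda>hs. hs i) =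
      gaussian_mechanism (\<delta> i) \<theta>"
    unfolding independent_instances_def
    using i \<delta> by (intro distr_PiM_component prob_space_gaussian_mechanism) auto
  then have "distributed (distr (independent_instances k \<delta> \<theta>) (gaussian_mechanism (\<delta> i) \<theta>) (\<lambda>hs. hs i))
    lborel (\<lambda>x. x \<bullet> b) (normal_density (\<theta> \<bullet> b) (sqrt (\<delta> i / real CARD('d))))"
    using gaussian_mechanism_coordinate[OF _ b, of "\<delta> i" \<theta>] \<delta> i by simp
  moreover have "(\<lambda>hs. hs i) \<in> measurable (independent_instances k \<delta> \<theta>) (gaussian_mechanism (\<delta> i) \<theta>)"
    using i by simp
  ultimately show ?thesis
    using i by (simp add: distributed_def distr_distr comp_def)
qed

text \<open>Each coordinate is a sum of independent normal variables with variances
  \<open>(w i)\<^sup>2 * \<delta> i / d\<close>, and summing over the \<open>d\<close> coordinates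
  removes the division by \<open>d\<close>. Nonzero weights keep every summand nondegenerate, so
  that it has a normal density.\<close>

lemma
  fixes \<theta> :: "real ^ 'd::finite"
  assumes k: "1 \<le> k" and \<delta>: "\<forall>i\<in>{1..k}. 0 < \<delta> i"
    and w: "\<And>i. w i \<noteq> 0" "(\<Sum>i=1..k. w i) = 1"
  shows has_bochner_integral_linear_combination:
      "has_bochner_integral (independent_instances k \<delta> \<theta>) (\<lambda>hs. \<Sum>i=1..k. w i *\<^sub>R hs i) \<theta>"
    and linear_combination_mse:
      "(\<integral>\<^sup>+hs. ennreal ((norm ((\<Sum>i=1..k. w i *\<^sub>R hs i) - \<theta>))\<^sup>2) \<partial>independent_instances k \<delta> \<theta>) =
       ennreal (\<Sum>i=1..k. (w i)\<^sup>2 * \<delta> i)"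
proof -
  let ?d = "real CARD('d)"
  let ?\<sigma> = "\<lambda>i. \<bar>w i\<bar> * sqrt (\<delta> i / ?d)"
  let ?s = "sqrt (\<Sum>i=1..k. (?\<sigma> i)\<^sup>2)"
  interpret prob_space "independent_instances k \<delta> \<theta>"
    by (rule prob_space_independent_instances[OF \<delta>])
  have \<sigma>: "0 < ?\<sigma> i" if "i \<in> {1..k}" for i
    using that \<delta> w(1)[of i] by simp
  have s: "0 < (\<Sum>i=1..k. (?\<sigma> i)\<^sup>2)"
    using k by (intro sum_pos zero_less_power \<sigma>) auto
  have D: "distributed (independent_instances k \<delta> \<theta>) lborel (\<lambda>hs. (\<Sum>i=1..k. w i *\<^sub>R hs i) \<bullet> b)
      (normal_density (\<theta> \<bullet> b) ?s)" if b: "b \<in> Basis" for b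
  proof -
    \<comment> \<open>The \<open>0 +\<close> gives each summand the affine shape of
      \<open>normal_density_affine\<close>.\<close>
    have "distributed (independent_instances k \<delta> \<theta>) lborel (\<lambda>hs. \<Sum>i=1..k. 0 + w i * (hs i \<bullet> b))
      (normal_density (\<Sum>i=1..k. 0 + w i * (\<theta> \<bullet> b)) ?s)"
    proof (intro sum_indep_normal normal_density_affine independent_instances_coordinate \<delta> b)
      show "indep_vars (\<lambda>i. borel) (\<lambda>i hs. 0 + w i * (hs i \<bullet> b)) {1..k}"
        by (rule indep_vars_compose2[OF indep_vars_independent_instances[OF k \<delta>]]) auto
    qed (use k \<sigma> w(1) \<delta> in auto)
    then show ?thesis
      using w(2) by (simp add: inner_sum_left flip: sum_distrib_right)
  qed
  have m: "(\<lambda>hs. \<Sum>i=1..k. w i *\<^sub>R hs i) \<in> borel_measurable (independent_instances k \<delta> \<theta>)"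
    by measurable
  show "has_bochner_integral (independent_instances k \<delta> \<theta>) (\<lambda>hs. \<Sum>i=1..k. w i *\<^sub>R hs i) \<theta>"
    using s by (intro has_bochner_integral_normal_coordinates[OF _ m D]) auto
  have "(\<Sum>i=1..k. (?\<sigma> i)\<^sup>2) = (\<Sum>i=1..k. (w i)\<^sup>2 * \<delta> i) / ?d"
    using \<delta> by (auto simp: power_mult_distrib sum_divide_distrib less_imp_le intro!: sum.cong)
  then show "(\<integral>\<^sup>+hs. ennreal ((norm ((\<Sum>i=1..k. w i *\<^sub>R hs i) - \<theta>))\<^sup>2) \<partial>independent_instances k \<delta> \<theta>) =
       ennreal (\<Sum>i=1..k. (w i)\<^sup>2 * \<delta> i)"
    using s by (subst nn_integral_norm_normal_coordinates[OF _ m D]) auto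
qed

section \<open>The Cramer-Rao bound\<close>

text \<open>Both measures agree on boxes, where the integral factors by Fubini, and boxes determine
  a product of sigma-finite measures. Passing to a density can destroy sigma-finiteness, whence the
  assumption \<open>N\<close>.\<close>

lemma density_PiM:
  assumes "product_sigma_finite M" "finite I"
    and f: "\<And>i. i \<in> I \<Longrightarrow> f i \<in> borel_measurable (M i)"
    and N: "product_sigma_finite (\<lambda>i. density (M i) (f i))"
  shows "density (PiM I M) (\<lambda>x. \<Prod>i\<in>I. f i (x i)) = PiM I (\<lambda>i. density (M i) (f i))"
proof -
  interpret M: product_sigma_finite M by fact
  note f [measurable]
  show ?thesis
  proof (rule product_sigma_finite.PiM_eqI[OF N \<open>finite I\<close>])
    show "sets (density (PiM I M) (\<lambda>x. \<Prod>i\<in>I. f i (x i))) = sets (PiM I (\<lambda>i. density (M i) (f i)))"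
      unfolding sets_density by (rule sets_PiM_cong) auto
    fix A assume A: "\<And>i. i \<in> I \<Longrightarrow> A i \<in> sets (density (M i) (f i))"
    then have [measurable]: "i \<in> I \<Longrightarrow> A i \<in> sets (M i)" for i by simp
    have PA: "Pi\<^sub>E I A \<in> sets (PiM I M)"
      using \<open>finite I\<close> by (intro sets_PiM_I_finite) auto
    have "emeasure (density (PiM I M) (\<lambda>x. \<Prod>i\<in>I. f i (x i))) (Pi\<^sub>E I A) =
        (\<integral>\<^sup>+x. (\<Prod>i\<in>I. f i (x i)) * indicator (Pi\<^sub>E I A) x \<partial>PiM I M)"
      by (rule emeasure_density[OF _ PA]) measurable
    also have "\<dots> = (\<integral>\<^sup>+x. (\<Prod>i\<in>I. f i (x i) * indicator (A i) (x i)) \<partial>PiM I M)"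
    proof (rule nn_integral_cong)
      fix x assume "x \<in> space (PiM I M)"
      then have "indicator (Pi\<^sub>E I A) x = (\<Prod>i\<in>I. indicator (A i) (x i) :: ennreal)"
        using \<open>finite I\<close> by (auto simp: indicator_def space_PiM PiE_iff prod_zero_iff)
      then show "(\<Prod>i\<in>I. f i (x i)) * indicator (Pi\<^sub>E I A) x = (\<Prod>i\<in>I. f i (x i) * indicator (A i) (x i))"
        by (simp add: prod.distrib)
    qed
    also have "\<dots> = (\<Prod>i\<in>I. \<integral>\<^sup>+x. f i x * indicator (A i) x \<partial>M i)"
      using \<open>finite I\<close> by (rule M.product_nn_integral_prod) measurable
    also have "\<dots> = (\<Prod>i\<in>I. emeasure (density (M i) (f i)) (A i))"
      by (intro prod.cong) (auto simp: emeasure_density)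
    finally show "emeasure (density (PiM I M) (\<lambda>x. \<Prod>i\<in>I. f i (x i))) (Pi\<^sub>E I A) = \<dots>" .
  qed
qed

section \<open>Likelihood ratio of a shift of the optimal model\<close>

definition likelihood_ratio ::
  "nat \<Rightarrow> (nat \<Rightarrow> real) \<Rightarrow> real ^ 'd::finite \<Rightarrow> real ^ 'd \<Rightarrow> (nat \<Rightarrow> real ^ 'd) \<Rightarrow> real" where
  "likelihood_ratio k \<delta> \<theta> h hs =
     exp (\<Sum>i=1..k. real CARD('d) / \<delta> i * (h \<bullet> (hs i - \<theta>) - (norm h)\<^sup>2 / 2))"

lemma measurable_likelihood_ratio [measurable]:
  "likelihood_ratio k \<delta> \<theta> h \<in> borel_measurable (independent_instances k \<delta>' \<theta>')"
  unfolding likelihood_ratio_def by measurable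

lemma independent_instances_shift:
  fixes \<theta> h :: "real ^ 'd::finite"
  assumes \<delta>: "\<forall>i\<in>{1..k}. 0 < \<delta> i"
  shows "independent_instances k \<delta> (\<theta> + h) =
    density (independent_instances k \<delta> \<theta>) (\<lambda>hs. ennreal (likelihood_ratio k \<delta> \<theta> h hs))"
proof -
  \<comment> \<open>\<open>product_sigma_finite\<close> speaks of every index, so the parameters
    outside \<open>{1..k}\<close> are set to the positive value 1.\<close>
  define \<delta>' where "\<delta>' i = (if i \<in> {1..k} then \<delta> i else 1)" for i
  let ?f = "\<lambda>i x. ennreal (exp (real CARD('d) / \<delta>' i * (h \<bullet> (x - \<theta>) - (norm h)\<^sup>2 / 2)))"
  have pos: "0 < \<delta>' i" for i using \<delta> by (simp add: \<delta>'_def)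
  have sf: "product_sigma_finite (\<lambda>i. gaussian_mechanism (\<delta>' i) \<theta>)" for \<theta> :: "real ^ 'd"
    unfolding product_sigma_finite_def
    using prob_space_gaussian_mechanism[OF pos] prob_space_imp_sigma_finite by blast
  have sf': "product_sigma_finite (\<lambda>i. density (gaussian_mechanism (\<delta>' i) \<theta>) (?f i))"
    using sf[of "\<theta> + h"] unfolding gaussian_mechanism_shift[OF pos] .
  have eq: "independent_instances k \<delta> \<theta> = PiM {1..k} (\<lambda>i. gaussian_mechanism (\<delta>' i) \<theta>)" for \<theta> :: "real ^ 'd"
    unfolding independent_instances_def by (intro PiM_cong) (auto simp: \<delta>'_def)
  have "independent_instances k \<delta> (\<theta> + h) =
      PiM {1..k} (\<lambda>i. density (gaussian_mechanism (\<delta>' i) \<theta>) (?f i))"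
    unfolding eq gaussian_mechanism_shift[OF pos] ..
  also have "\<dots> = density (independent_instances k \<delta> \<theta>) (\<lambda>hs. \<Prod>i=1..k. ?f i (hs i))"
    unfolding eq
    by (rule density_PiM[symmetric, OF sf _ _ sf']) simp_all
  also have "(\<lambda>hs. \<Prod>i=1..k. ?f i (hs i)) = (\<lambda>hs. ennreal (likelihood_ratio k \<delta> \<theta> h hs))"
    by (auto simp: likelihood_ratio_def exp_sum prod_ennreal \<delta>'_def fun_eq_iff intro!: prod.cong)
  finally show ?thesis .
qed

text \<open>The mean is the total mass of the shifted law. The square of the ratio for
  \<open>h\<close> is the ratio for \<open>2 *\<^sub>R h\<close> times a constant, so the second
  moment reduces to a mean at another shift.\<close>

lemma
  fixes \<theta> h :: "real ^ 'd::finite"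
  assumes \<delta>: "\<forall>i\<in>{1..k}. 0 < \<delta> i"
  shows likelihood_ratio_mean:
      "has_bochner_integral (independent_instances k \<delta> \<theta>) (likelihood_ratio k \<delta> \<theta> h) 1"
    and likelihood_ratio_second_moment:
      "has_bochner_integral (independent_instances k \<delta> \<theta>) (\<lambda>hs. (likelihood_ratio k \<delta> \<theta> h hs)\<^sup>2)
        (exp ((norm h)\<^sup>2 * (\<Sum>i=1..k. real CARD('d) / \<delta> i)))"
proof -
  have mean: "has_bochner_integral (independent_instances k \<delta> \<theta>) (likelihood_ratio k \<delta> \<theta> h) 1" for h
  proof (rule has_bochner_integral_nn_integral)
    interpret prob_space "independent_instances k \<delta> (\<theta> + h)"
      by (rule prob_space_independent_instances[OF \<delta>])
    have "(\<integral>\<^sup>+hs. ennreal (likelihood_ratio k \<delta> \<theta> h hs) \<partial>independent_instances k \<delta> \<theta>) =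
        (\<integral>\<^sup>+hs. 1 \<partial>independent_instances k \<delta> (\<theta> + h))"
      unfolding independent_instances_shift[OF \<delta>] by (subst nn_integral_density) auto
    then show "(\<integral>\<^sup>+hs. ennreal (likelihood_ratio k \<delta> \<theta> h hs) \<partial>independent_instances k \<delta> \<theta>) = ennreal 1"
      by (simp add: emeasure_space_1)
  qed (auto simp: likelihood_ratio_def)
  then show "has_bochner_integral (independent_instances k \<delta> \<theta>) (likelihood_ratio k \<delta> \<theta> h) 1" .
  have "(likelihood_ratio k \<delta> \<theta> h hs)\<^sup>2 =
      likelihood_ratio k \<delta> \<theta> (2 *\<^sub>R h) hs * exp ((norm h)\<^sup>2 * (\<Sum>i=1..k. real CARD('d) / \<delta> i))" for hs
    unfolding likelihood_ratio_def
    by (simp add: sum_distrib_left power_mult_distrib algebra_simps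
        flip: exp_double exp_add sum.distrib sum_subtractf sum_negf)
  then show "has_bochner_integral (independent_instances k \<delta> \<theta>) (\<lambda>hs. (likelihood_ratio k \<delta> \<theta> h hs)\<^sup>2)
      (exp ((norm h)\<^sup>2 * (\<Sum>i=1..k. real CARD('d) / \<delta> i)))"
    using has_bochner_integral_mult_left[OF mean[of "2 *\<^sub>R h"]] by simp
qed

text \<open>With \<open>u = (g - \<theta>) \<bullet> b\<close> and \<open>L\<close> the likelihood ratio of \<open>\<theta> + t b\<close>, this expands
  \<open>0 \<le> E (u - c (L - 1))\<^sup>2\<close>, where \<open>E u = 0\<close> and \<open>E (L u) = t\<close> by unbiasedness at \<open>\<theta>\<close> and at \<open>\<theta> + t b\<close>.\<close>

lemma hammersley_chapman_robbins:
  fixes \<theta> b :: "real ^ 'd::finite"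
  assumes \<delta>: "\<forall>i\<in>{1..k}. 0 < \<delta> i"
    and g: "unbiased k \<delta> g" and b: "norm b = 1"
    and V: "has_bochner_integral (independent_instances k \<delta> \<theta>) (\<lambda>hs. ((g hs - \<theta>) \<bullet> b)\<^sup>2) V"
  shows "2 * c * t - c\<^sup>2 * (exp (t\<^sup>2 * (\<Sum>i=1..k. real CARD('d) / \<delta> i)) - 1) \<le> V"
proof -
  let ?P = "independent_instances k \<delta>"
  let ?u = "\<lambda>hs. (g hs - \<theta>) \<bullet> b"
  let ?L = "likelihood_ratio k \<delta> \<theta> (t *\<^sub>R b)"
  let ?E = "exp (t\<^sup>2 * (\<Sum>i=1..k. real CARD('d) / \<delta> i))"
  interpret prob_space "?P \<theta>" by (rule prob_space_independent_instances[OF \<delta>])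
  have gm: "has_bochner_integral (?P \<theta>') g \<theta>'" for \<theta>'
    using g by (simp add: unbiased_def)
  have bb: "b \<bullet> b = 1" using b by (simp add: norm_eq_1)
  have um: "has_bochner_integral (?P \<theta>') ?u ((\<theta>' - \<theta>) \<bullet> b)" for \<theta>'
  proof -
    interpret Q: prob_space "?P \<theta>'" by (rule prob_space_independent_instances[OF \<delta>])
    have "has_bochner_integral (?P \<theta>') (\<lambda>_. \<theta>) \<theta>"
      by (simp add: has_bochner_integral_iff Q.prob_space)
    then show ?thesis
      by (intro has_bochner_integral_inner_left has_bochner_integral_diff gm)
  qed
  have u0: "has_bochner_integral (?P \<theta>) ?u 0"
    using um[of \<theta>] by simp
  \<comment> \<open>Change of measure: the expectation of \<open>?u\<close> under the shifted law is
    that of \<open>?L * ?u\<close> under the law at \<theta>.\<close>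
  have uL: "has_bochner_integral (?P \<theta>) (\<lambda>hs. ?L hs * ?u hs) t"
  proof -
    have [measurable]: "?u \<in> borel_measurable (?P \<theta>)"
      using u0 by (rule borel_measurable_has_bochner_integral)
    have "has_bochner_integral (density (?P \<theta>) (\<lambda>hs. ennreal (?L hs))) ?u t"
      using um[of "\<theta> + t *\<^sub>R b"] by (simp add: independent_instances_shift[OF \<delta>] bb)
    moreover have "AE hs in ?P \<theta>. 0 \<le> ?L hs" by (simp add: likelihood_ratio_def)
    ultimately show ?thesis
      by (simp add: has_bochner_integral_iff integrable_density integral_density)
  qed
  note L1 = likelihood_ratio_mean[OF \<delta>, where \<theta> = \<theta> and h = "t *\<^sub>R b"]
  note L2 = likelihood_ratio_second_moment[OF \<delta>, where \<theta> = \<theta> and h = "t *\<^sub>R b"]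
  have one: "has_bochner_integral (?P \<theta>) (\<lambda>_. 1 :: real) 1"
    by (simp add: has_bochner_integral_iff prob_space)
  have "has_bochner_integral (?P \<theta>)
      (\<lambda>hs. (?u hs)\<^sup>2 - 2 * c * (?L hs * ?u hs - ?u hs) + c\<^sup>2 * ((?L hs)\<^sup>2 - 2 * ?L hs + 1))
      (V - 2 * c * (t - 0) + c\<^sup>2 * (?E - 2 * 1 + 1))"
    using L2 b
    by (intro has_bochner_integral_add has_bochner_integral_diff has_bochner_integral_mult_right
        V uL u0 L1 one) (simp add: power_mult_distrib)
  also have "(\<lambda>hs. (?u hs)\<^sup>2 - 2 * c * (?L hs * ?u hs - ?u hs) + c\<^sup>2 * ((?L hs)\<^sup>2 - 2 * ?L hs + 1)) =
      (\<lambda>hs. (?u hs - c * (?L hs - 1))\<^sup>2)"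
    by (simp add: fun_eq_iff power2_eq_square algebra_simps)
  finally have "0 \<le> V - 2 * c * (t - 0) + c\<^sup>2 * (?E - 2 * 1 + 1)"
    by (auto dest!: has_bochner_integral_integral_eq[symmetric] intro: integral_nonneg_AE)
  then show ?thesis by simp
qed

text \<open>Here \<open>J\<close> is the Fisher information in the direction \<open>b\<close>.
  Setting \<open>s = t\<^sup>2 * J\<close> turns the finite-shift bound into
  \<open>2 - (exp s - 1) / s \<le> J * V\<close>, whose left side tends to 1 as \<open>s\<close>
  decreases to 0.\<close>

lemma cramer_rao_coordinate:
  fixes \<theta> b :: "real ^ 'd::finite"
  assumes k: "1 \<le> k" and \<delta>: "\<forall>i\<in>{1..k}. 0 < \<delta> i"
    and g: "unbiased k \<delta> g" and b: "norm b = 1"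
    and V: "has_bochner_integral (independent_instances k \<delta> \<theta>) (\<lambda>hs. ((g hs - \<theta>) \<bullet> b)\<^sup>2) V"
  shows "1 \<le> (\<Sum>i=1..k. real CARD('d) / \<delta> i) * V"
proof -
  define J where "J = (\<Sum>i=1..k. real CARD('d) / \<delta> i)"
  have J: "0 < J"
    unfolding J_def using k \<delta> by (intro sum_pos) auto
  have "2 - (exp s - 1) / s \<le> J * V" if s: "0 < s" for s
  proof -
    \<comment> \<open>the best \<open>c\<close> to leading order in \<open>t\<close> is \<open>1 / (t J)\<close>\<close>
    define t where "t = sqrt (s / J)"
    have t: "0 < t" "t\<^sup>2 * J = s" using s J by (auto simp: t_def)
    have "2 * (1 / (t * J)) * t - (1 / (t * J))\<^sup>2 * (exp s - 1) \<le> V"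
      using hammersley_chapman_robbins[OF \<delta> g b V, of "1 / (t * J)" t] t unfolding J_def by simp
    then have "J * (2 * (1 / (t * J)) * t - (1 / (t * J))\<^sup>2 * (exp s - 1)) \<le> J * V"
      using J by simp
    also have "J * (2 * (1 / (t * J)) * t - (1 / (t * J))\<^sup>2 * (exp s - 1)) = 2 - (exp s - 1) / s"
      using t(1) J s by (simp add: field_simps power2_eq_square flip: t(2))
    finally show ?thesis .
  qed
  then have "eventually (\<lambda>s. 2 - (exp s - 1) / s \<le> J * V) (at_right 0)"
    by (auto simp: eventually_at_right_field intro: exI[of _ 1])
  moreover have "((\<lambda>s :: real. 2 - (exp s - 1) / s) \<longlongrightarrow> 2 - 1) (at_right 0)"
    by (intro tendsto_diff tendsto_const filterlim_mono[OF lim_exp_minus_1] at_le) auto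
  ultimately have "2 - 1 \<le> J * V"
    by (intro tendsto_upperbound) auto
  then show ?thesis by (simp add: J_def)
qed

text \<open>Summing \<open>1 \<le> J * V b\<close> over the \<open>d\<close> coordinates gives
  \<open>d \<le> J * \<epsilon>\<close>. Since \<open>J\<close> is \<open>d\<close> times the total
  precision, the factor \<open>d\<close> cancels.\<close>

lemma cramer_rao:
  fixes \<theta> :: "real ^ 'd::finite"
  assumes k: "1 \<le> k" and \<delta>: "\<forall>i\<in>{1..k}. 0 < \<delta> i"
    and g: "unbiased k \<delta> g" and \<epsilon>: "0 < \<epsilon>"
    and mse: "(\<integral>\<^sup>+hs. ennreal ((norm (g hs - \<theta>))\<^sup>2) \<partial>independent_instances k \<delta> \<theta>) \<le> ennreal \<epsilon>"
  shows "1 / \<epsilon> \<le> (\<Sum>i=1..k. 1 / \<delta> i)"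
proof -
  let ?P = "independent_instances k \<delta> \<theta>"
  let ?J = "\<Sum>i=1..k. real CARD('d) / \<delta> i"
  define V where "V b = (\<integral>hs. ((g hs - \<theta>) \<bullet> b)\<^sup>2 \<partial>?P)" for b
  have "has_bochner_integral ?P g \<theta>" using g by (simp add: unbiased_def)
  then have [measurable]: "g \<in> borel_measurable ?P"
    by (rule borel_measurable_has_bochner_integral)
  \<comment> \<open>A finite nonnegative integral makes the error square integrable, so each
    \<open>V b\<close> is a genuine second moment and not the default value 0 of the Bochner
    integral.\<close>
  have int: "integrable ?P (\<lambda>hs. (norm (g hs - \<theta>))\<^sup>2)"
    using mse by (intro integrableI_bounded) (auto intro: le_less_trans)
  have V: "has_bochner_integral ?P (\<lambda>hs. ((g hs - \<theta>) \<bullet> b)\<^sup>2) (V b)" if b: "b \<in> Basis" for b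
    unfolding V_def
  proof (intro has_bochner_integral_integrable Bochner_Integration.integrable_bound[OF int] AE_I2)
    fix hs
    have "\<bar>(g hs - \<theta>) \<bullet> b\<bar> \<le> norm (g hs - \<theta>)" using b by (rule Basis_le_norm)
    then show "norm (((g hs - \<theta>) \<bullet> b)\<^sup>2) \<le> norm ((norm (g hs - \<theta>))\<^sup>2)"
      by (simp add: abs_le_square_iff[symmetric])
  qed measurable
  have "(\<integral>hs. (norm (g hs - \<theta>))\<^sup>2 \<partial>?P) = (\<Sum>b\<in>Basis. V b)"
  proof (rule has_bochner_integral_integral_eq)
    have "has_bochner_integral ?P (\<lambda>hs. \<Sum>b\<in>Basis. ((g hs - \<theta>) \<bullet> b)\<^sup>2) (\<Sum>b\<in>Basis. V b)"
      by (intro has_bochner_integral_sum V)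
    then show "has_bochner_integral ?P (\<lambda>hs. (norm (g hs - \<theta>))\<^sup>2) (\<Sum>b\<in>Basis. V b)"
      by (simp add: power2_norm_eq_sum_inner)
  qed
  moreover have "(\<integral>hs. (norm (g hs - \<theta>))\<^sup>2 \<partial>?P) \<le> \<epsilon>"
    using mse \<epsilon> int by (subst (asm) nn_integral_eq_integral) auto
  ultimately have VE: "(\<Sum>b\<in>Basis. V b) \<le> \<epsilon>" by simp
  have J: "0 < ?J" using k \<delta> by (intro sum_pos) auto
  have "real CARD('d) = (\<Sum>b\<in>(Basis :: (real ^ 'd) set). 1)" by simp
  also have "\<dots> \<le> (\<Sum>b\<in>Basis. ?J * V b)"
    using k \<delta> by (intro sum_mono cramer_rao_coordinate[OF k \<delta> g _ V]) auto
  also have "\<dots> \<le> ?J * \<epsilon>"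
    using VE J by (simp flip: sum_distrib_left)
  also have "?J = real CARD('d) * (\<Sum>i=1..k. 1 / \<delta> i)"
    by (simp add: sum_distrib_left)
  finally show ?thesis
    using \<epsilon> by (simp add: field_simps)
qed

section \<open>Arbitrage\<close>

text \<open>Eliminates estimators and measures: what remains concerns \<open>p\<close> as a function
  of a real parameter. Cramer-Rao gives one direction, inverse-variance weighting the other.\<close>

lemma k_arbitrage_square_loss_iff:
  fixes err :: "real ^ 'd::finite \<Rightarrow> 'D \<Rightarrow> real"
  assumes k: "1 \<le> k"
  shows "k_arbitrage k (square_loss err) err p D \<longleftrightarrow>
    (\<exists>\<delta>. (\<forall>i\<le>k. 0 < \<delta> i) \<and> 1 / \<delta> 0 \<le> (\<Sum>i=1..k. 1 / \<delta> i) \<and>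
      (\<Sum>i=1..k. p (\<delta> i) D) < p (\<delta> 0) D)"
proof
  assume "k_arbitrage k (square_loss err) err p D"
  then obtain \<delta> g where pos: "\<forall>i\<le>k. 0 < \<delta> i" and p: "(\<Sum>i=1..k. p (\<delta> i) D) < p (\<delta> 0) D"
    and g: "unbiased k \<delta> g"
    and mse: "(\<integral>\<^sup>+hs. ennreal (square_loss err (g hs) D) \<partial>independent_instances k \<delta> (optimal_model err D))
      \<le> (\<integral>\<^sup>+h. ennreal (square_loss err h D) \<partial>gaussian_mechanism (\<delta> 0) (optimal_model err D))"
    unfolding k_arbitrage_def by blast
  have "1 / \<delta> 0 \<le> (\<Sum>i=1..k. 1 / \<delta> i)"
    using pos mse by (intro cramer_rao[OF k _ g]) (auto simp: square_loss_def gaussian_mechanism_mse)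
  with pos p show "\<exists>\<delta>. (\<forall>i\<le>k. 0 < \<delta> i) \<and> 1 / \<delta> 0 \<le> (\<Sum>i=1..k. 1 / \<delta> i) \<and>
      (\<Sum>i=1..k. p (\<delta> i) D) < p (\<delta> 0) D" by blast
next
  assume "\<exists>\<delta>. (\<forall>i\<le>k. 0 < \<delta> i) \<and> 1 / \<delta> 0 \<le> (\<Sum>i=1..k. 1 / \<delta> i) \<and>
      (\<Sum>i=1..k. p (\<delta> i) D) < p (\<delta> 0) D"
  then obtain \<delta> where pos: "\<forall>i\<le>k. 0 < \<delta> i" and le: "1 / \<delta> 0 \<le> (\<Sum>i=1..k. 1 / \<delta> i)"
    and p: "(\<Sum>i=1..k. p (\<delta> i) D) < p (\<delta> 0) D" by blast
  define S where "S = (\<Sum>i=1..k. 1 / \<delta> i)"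
  have S: "0 < S" unfolding S_def using k pos by (intro sum_pos) auto
  \<comment> \<open>The weights are proportional to the precisions. The value 1 outside
    \<open>{1..k}\<close> is there because the result on linear combinations asks for
    \<open>w i \<noteq> 0\<close> at every index.\<close>
  define w where "w i = (if i \<in> {1..k} then 1 / (\<delta> i * S) else 1)" for i
  let ?g = "\<lambda>hs :: nat \<Rightarrow> real ^ 'd. \<Sum>i=1..k. w i *\<^sub>R hs i"
  have w0: "w i \<noteq> 0" for i
    using pos S by (auto simp: w_def less_le)
  have w1: "(\<Sum>i=1..k. w i) = 1"
  proof -
    have "(\<Sum>i=1..k. w i) = (\<Sum>i=1..k. 1 / \<delta> i / S)"
      by (intro sum.cong) (auto simp: w_def)
    also have "\<dots> = 1"
      using S by (subst sum_divide_distrib[symmetric]) (simp add: S_def)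
    finally show ?thesis .
  qed
  have pos': "\<forall>i\<in>{1..k}. 0 < \<delta> i" using pos by auto
  \<comment> \<open>For these weights \<open>w i * \<delta> i\<close> is the constant
    \<open>1 / S\<close>, so the error collapses to \<open>1 / S\<close> times the sum of the
    weights.\<close>
  have "(\<Sum>i=1..k. (w i)\<^sup>2 * \<delta> i) = (\<Sum>i=1..k. w i * (1 / S))"
  proof (intro sum.cong refl)
    fix i assume "i \<in> {1..k}"
    then show "(w i)\<^sup>2 * \<delta> i = w i * (1 / S)"
      using pos'[rule_format, of i] S by (simp add: w_def power2_eq_square)
  qed
  also have "\<dots> = 1 / S"
    using w1 by (simp flip: sum_distrib_right sum_divide_distrib)
  also have "\<dots> \<le> \<delta> 0"
    using le[folded S_def] pos S by (simp add: field_simps)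
  finally have mse: "(\<Sum>i=1..k. (w i)\<^sup>2 * \<delta> i) \<le> \<delta> 0" .
  show "k_arbitrage k (square_loss err) err p D"
    unfolding k_arbitrage_def
  proof (intro exI[of _ \<delta>] exI[of _ ?g] conjI pos p)
    show "?g \<in> borel_measurable (Pi\<^sub>M {1..k} (\<lambda>_. borel))" by measurable
    show "unbiased k \<delta> ?g"
      unfolding unbiased_def using has_bochner_integral_linear_combination[OF k pos' w0 w1] by blast
    show "(\<integral>\<^sup>+hs. ennreal (square_loss err (?g hs) D) \<partial>independent_instances k \<delta> (optimal_model err D))
      \<le> (\<integral>\<^sup>+h. ennreal (square_loss err h D) \<partial>gaussian_mechanism (\<delta> 0) (optimal_model err D))"
      unfolding square_loss_def linear_combination_mse[OF k pos' w0 w1]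
      using mse pos by (simp add: gaussian_mechanism_mse ennreal_leI)
  qed
qed

theorem theorem5:
  fixes err :: "real ^ 'd::finite \<Rightarrow> 'D \<Rightarrow> real"
    and p :: "real \<Rightarrow> 'D \<Rightarrow> real"
    and D :: 'D
  assumes "error_function err"
    and "has_optimal_model err D"
    and "pricing_function p"
  shows "arbitrage_free (square_loss err) err p D \<longleftrightarrow>
    (\<forall>\<delta>\<^sub>1>0. \<forall>\<delta>\<^sub>2>0. \<forall>\<delta>\<^sub>3>0.
       (1 / \<delta>\<^sub>1 = 1 / \<delta>\<^sub>2 + 1 / \<delta>\<^sub>3 \<longrightarrow> p \<delta>\<^sub>1 D \<le> p \<delta>\<^sub>2 D + p \<delta>\<^sub>3 D) \<and>
       (\<delta>\<^sub>1 \<le> \<delta>\<^sub>2 \<longrightarrow> p \<delta>\<^sub>1 D \<ge> p \<delta>\<^sub>2 D))" (is "?free \<longleftrightarrow> ?cond")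
proof
  assume free': ?free
  have free: "p (\<delta> 0) D \<le> (\<Sum>i=1..k. p (\<delta> i) D)"
    if "1 \<le> k" "\<forall>i\<le>k. 0 < \<delta> i" "1 / \<delta> 0 \<le> (\<Sum>i=1..k. 1 / \<delta> i)" for k :: nat and \<delta>
  proof (rule ccontr)
    assume "\<not> p (\<delta> 0) D \<le> (\<Sum>i=1..k. p (\<delta> i) D)"
    with that have "k_arbitrage k (square_loss err) err p D"
      unfolding k_arbitrage_square_loss_iff[OF that(1)] not_le by blast
    with free' that(1) show False by (simp add: arbitrage_free_def)
  qed
  show ?cond
  proof (intro allI impI conjI)
    fix a b c :: real
    assume pos: "0 < a" "0 < b" "0 < c"
    show "p a D \<le> p b D + p c D" if "1 / a = 1 / b + 1 / c"
      \<comment> \<open>Instances with parameters \<open>b\<close> and \<open>c\<close> are combined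
        to replace one with parameter \<open>a\<close>.\<close>
      using free[of 2 "\<lambda>i. if i = 0 then a else if i = 1 then b else c"] pos that
      by (simp add: numeral_2_eq_2)
    show "p b D \<le> p a D" if "a \<le> b"
      \<comment> \<open>A single instance with the smaller parameter \<open>a\<close> replaces one
        with parameter \<open>b\<close>.\<close>
      using free[of 1 "\<lambda>i. if i = 0 then b else a"] pos that by (simp add: frac_le)
  qed
next
  assume cond: ?cond
  \<comment> \<open>Precisions add, so condition 1 extends from two instances to \<open>k\<close> by
    splitting off the last one.\<close>
  have sub: "p (1 / (\<Sum>i=1..k. 1 / \<delta> i)) D \<le> (\<Sum>i=1..k. p (\<delta> i) D)"
    if "1 \<le> k" "\<forall>i\<in>{1..k}. 0 < \<delta> i" for k :: nat and \<delta>
    using that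
  proof (induction k rule: dec_induct)
    case base
    then show ?case by simp
  next
    case (step k)
    let ?S = "\<Sum>i=1..k. 1 / \<delta> i"
    have S: "0 < ?S" using step by (intro sum_pos) auto
    have \<delta>: "0 < \<delta> (Suc k)" using step by auto
    have "p (1 / (?S + 1 / \<delta> (Suc k))) D \<le> p (1 / ?S) D + p (\<delta> (Suc k)) D"
      using cond[rule_format, of "1 / (?S + 1 / \<delta> (Suc k))" "1 / ?S" "\<delta> (Suc k)"] S \<delta>
      by (simp add: add_pos_pos)
    then show ?case using step by simp
  qed
  have "\<not> k_arbitrage k (square_loss err) err p D" if k: "1 \<le> k" for k
  proof
    assume "k_arbitrage k (square_loss err) err p D"
    then obtain \<delta> where pos: "\<forall>i\<le>k. 0 < \<delta> i" and le: "1 / \<delta> 0 \<le> (\<Sum>i=1..k. 1 / \<delta> i)"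
      and p: "(\<Sum>i=1..k. p (\<delta> i) D) < p (\<delta> 0) D"
      unfolding k_arbitrage_square_loss_iff[OF k] by blast
    have S: "0 < (\<Sum>i=1..k. 1 / \<delta> i)"
      using k pos by (intro sum_pos) auto
    have "1 / (\<Sum>i=1..k. 1 / \<delta> i) \<le> \<delta> 0"
      using le S pos by (simp add: field_simps)
    then have "p (\<delta> 0) D \<le> p (1 / (\<Sum>i=1..k. 1 / \<delta> i)) D"
      \<comment> \<open>Condition 2 applies because the bundle is at least as precise as
        \<open>\<delta> 0\<close>. The final \<open>1\<close> is an arbitrary positive value for the
        third quantified parameter.\<close>
      using cond[rule_format, of "1 / (\<Sum>i=1..k. 1 / \<delta> i)" "\<delta> 0" 1] S pos by simp
    also have "\<dots> \<le> (\<Sum>i=1..k. p (\<delta> i) D)"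
      using pos by (intro sub k) auto
    finally show False using p by simp
  qed
  then show ?free by (simp add: arbitrage_free_def)
qed

end
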